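(* Let $P$ and $Q$ be finite posets. If $P$ and $Q$ are LE-cactus, then the disjoint union $P+Q$ is LE-cactus.
   Context: For a finite poset $P$ with $n$ elements, a linear extension is a list $\ell=(p_1,\dots,p_n)$ of all elements of $P$ such that $p_a<_P p_b$ implies $a<b$; ${\mathcal{L}}(P)$ denotes the set of linear extensions. For $1\le i\le n-1$ the Bender--Knuth move $t_i:{\mathcal{L}}(P)\to{\mathcal{L}}(P)$ sends $(p_1,\dots,p_n)$ to the list with $p_i$ and $p_{i+1}$ swapped if $p_i$ and $p_{i+1}$ are incomparable in $P$, and fixes $\ell$ otherwise. The group $\mathcal{BK}_P$ is the subgroup of the symmetric group on ${\mathcal{L}}(P)$ generated by $t_1,\dots,t_{n-1}$; a relation $w=1$ (for a word $w$ in the $t_i$) holds in $\mathcal{BK}_P$ if the corresponding product of permutations is the identity. Define $q_m=t_1(t_2t_1)(t_3t_2t_1)\cdots(t_mt_{m-1}\cdots t_1)$ and $q_{jk}=q_{k-1}q_{k-j}q_{k-1}$. An $n$-element poset $P$ is LE-cactus if $(t_iq_{jk})^2=1$ holds in $\mathcal{BK}_P$ for all integers $i,j,k$ with $2\le i+1<j<k\le n$. The disjoint union $P+Q$ has underlying set the disjoint union of $P$ and $Q$, with $x\le y$ iff both lie in the same poset and are related there. *)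

theory Defs
  imports Main "HOL-Algebra.Bij" "HOL-Algebra.Elementary_Groups"
begin

text \<open>A poset is a carrier \<open>A\<close> with a reflexive order relation \<open>r\<close> such that
  \<open>partial_order_on A r\<close>; \<open>A\<close> may be empty. Lists are indexed from 0, so the entry
  \<open>p\<^sub>i\<close> of \<open>(p\<^sub>1, \<dots>, p\<^sub>n)\<close> is \<open>l ! (i - 1)\<close>.\<close>

definition linear_extensions :: "'a set \<Rightarrow> 'a rel \<Rightarrow> 'a list set" where
  "linear_extensions A r =
     {l. distinct l \<and> set l = A \<and>
         (\<forall>a<length l. \<forall>b<length l. (l ! a, l ! b) \<in> r \<and> l ! a \<noteq> l ! b \<longrightarrow> a < b)}"

definition incomparable :: "'a rel \<Rightarrow> 'a \<Rightarrow> 'a \<Rightarrow> bool" where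
  "incomparable r x y \<longleftrightarrow> (x, y) \<notin> r \<and> (y, x) \<notin> r"

text \<open>The restriction makes \<open>bk_move A r i\<close> an extensional function, as elements of
  \<^const>\<open>BijGroup\<close> are required to be. Only \<open>1 \<le> i < card A\<close> is meaningful.\<close>

definition bk_move :: "'a set \<Rightarrow> 'a rel \<Rightarrow> nat \<Rightarrow> 'a list \<Rightarrow> 'a list" where
  "bk_move A r i =
     (\<lambda>l\<in>linear_extensions A r.
        if incomparable r (l ! (i - 1)) (l ! i)
        then l[i - 1 := l ! i, i := l ! (i - 1)] else l)"

definition BK :: "'a set \<Rightarrow> 'a rel \<Rightarrow> ('a list \<Rightarrow> 'a list) monoid" where
  "BK A r = subgroup_generated (BijGroup (linear_extensions A r)) (bk_move A r ` {1..<card A})"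

text \<open>A word \<open>t\<^bsub>i\<^esub> t\<^bsub>j\<^esub> \<dots>\<close> is represented by its list of indices
  \<open>[i, j, \<dots>]\<close>. Multiplication in \<^const>\<open>BijGroup\<close> is composition of functions, so
  the rightmost letter acts first.\<close>

definition bk_eval :: "'a set \<Rightarrow> 'a rel \<Rightarrow> nat list \<Rightarrow> 'a list \<Rightarrow> 'a list" where
  "bk_eval A r w = foldr (\<otimes>\<^bsub>BK A r\<^esub>) (map (bk_move A r) w) \<one>\<^bsub>BK A r\<^esub>"

definition bk_relation_holds :: "'a set \<Rightarrow> 'a rel \<Rightarrow> nat list \<Rightarrow> bool" where
  "bk_relation_holds A r w \<longleftrightarrow> bk_eval A r w = \<one>\<^bsub>BK A r\<^esub>"

definition q_word :: "nat \<Rightarrow> nat list" where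
  "q_word m = concat (map (\<lambda>a. rev [1..<Suc a]) [1..<Suc m])"

definition qq_word :: "nat \<Rightarrow> nat \<Rightarrow> nat list" where
  "qq_word j k = q_word (k - 1) @ q_word (k - j) @ q_word (k - 1)"

definition LE_cactus :: "'a set \<Rightarrow> 'a rel \<Rightarrow> bool" where
  "LE_cactus A r \<longleftrightarrow>
     (\<forall>i j k. 2 \<le> i + 1 \<and> i + 1 < j \<and> j < k \<and> k \<le> card A \<longrightarrow>
        bk_relation_holds A r ((i # qq_word j k) @ (i # qq_word j k)))"

text \<open>The carrier of the disjoint union is \<open>A <+> B\<close>.\<close>

definition sum_order :: "'a rel \<Rightarrow> 'b rel \<Rightarrow> ('a + 'b) rel" where
  "sum_order r s = {(Inl x, Inl y) |x y. (x, y) \<in> r} \<union> {(Inr x, Inr y) |x y. (x, y) \<in> s}"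

lemma partial_order_on_sum_order:
  assumes "partial_order_on A r" "partial_order_on B s"
  shows "partial_order_on (A <+> B) (sum_order r s)"
proof -
  have sub: "r \<subseteq> A \<times> A" "s \<subseteq> B \<times> B"
    and rf: "\<And>x. x \<in> A \<Longrightarrow> (x, x) \<in> r" "\<And>x. x \<in> B \<Longrightarrow> (x, x) \<in> s"
    and tr: "trans r" "trans s" and an: "antisym r" "antisym s"
    using assms by (auto simp: partial_order_on_def preorder_on_def refl_on_def)
  have "sum_order r s \<subseteq> (A <+> B) \<times> (A <+> B)"
    using sub unfolding sum_order_def by auto
  moreover have "refl_on (A <+> B) (sum_order r s)"
    using rf unfolding sum_order_def refl_on_def by auto
  moreover have "trans (sum_order r s)"
    by (rule transI) (auto simp: sum_order_def intro: transD[OF tr(1)] transD[OF tr(2)])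
  moreover have "antisym (sum_order r s)"
    by (rule antisymI) (auto simp: sum_order_def dest: antisymD[OF an(1)] antisymD[OF an(2)])
  ultimately show ?thesis
    by (simp add: partial_order_on_def preorder_on_def)
qed

lemma q_word_3: "q_word 3 = [1, 2, 1, 3, 2, 1]"
  by (simp add: q_word_def upt_rec numeral_eq_Suc)

text \<open>The Bender--Knuth moves are permutations of the linear extensions, so the intersection
  with the carrier in \<^const>\<open>subgroup_generated\<close> discards no generator.\<close>

lemma bk_move_involution:
  assumes i: "1 \<le> i" "i < card A" and l: "l \<in> linear_extensions A r"
  shows "bk_move A r i l \<in> linear_extensions A r \<and> bk_move A r i (bk_move A r i l) = l"
proof (cases "incomparable r (l ! (i - 1)) (l ! i)")
  case False
  then show ?thesis using l by (simp add: bk_move_def)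
next
  case True
  define m where "m = l[i - 1 := l ! i, i := l ! (i - 1)]"
  define f where "f = (\<lambda>a. if a = i then i - 1 else if a = i - 1 then i else a)"
  have d: "distinct l" and s: "set l = A"
    and o: "\<And>a b. a < length l \<Longrightarrow> b < length l \<Longrightarrow> (l ! a, l ! b) \<in> r \<Longrightarrow> l ! a \<noteq> l ! b \<Longrightarrow> a < b"
    using l by (auto simp: linear_extensions_def)
  have len: "i < length l" using i s d distinct_card by metis
  have nth: "m ! a = l ! f a" if "a < length l" for a
    using that len i by (auto simp: m_def f_def nth_list_update)
  have lm: "length m = length l" by (simp add: m_def)
  have dm: "distinct m" "set m = A"
    using d s len i unfolding m_def by (simp_all add: less_imp_diff_less)
  have om: "a < b" if ab: "a < length l" "b < length l" "(m ! a, m ! b) \<in> r" "m ! a \<noteq> m ! b" for a b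
  proof -
    have lt: "f a < length l" "f b < length l" using ab len by (auto simp: f_def)
    have "f a < f b" using o[OF lt] ab nth by simp
    moreover have "\<not> (f a = i - 1 \<and> f b = i)"
      using True ab nth unfolding incomparable_def by auto
    ultimately show ?thesis using i unfolding f_def by (auto split: if_splits)
  qed
  have mL: "m \<in> linear_extensions A r"
    unfolding linear_extensions_def using dm om lm by auto
  have 1: "bk_move A r i l = m" using True l by (simp add: bk_move_def m_def)
  have m1: "m ! (i - 1) = l ! i" "m ! i = l ! (i - 1)" using len i by (simp_all add: m_def)
  have "incomparable r (m ! (i - 1)) (m ! i)" using True m1 by (simp add: incomparable_def)
  then have "bk_move A r i m = m[i - 1 := l ! (i - 1), i := l ! i]"
    using mL m1 by (simp add: bk_move_def)
  also have "\<dots> = l" using i by (simp add: m_def list_update_swap)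
  finally show ?thesis using 1 mL by simp
qed

lemma bk_move_in_BijGroup:
  assumes "1 \<le> i" "i < card A"
  shows "bk_move A r i \<in> carrier (BijGroup (linear_extensions A r))"
proof -
  have "bij_betw (bk_move A r i) (linear_extensions A r) (linear_extensions A r)"
    by (rule bij_betw_byWitness[where f' = "bk_move A r i"])
      (use bk_move_involution[OF assms] in auto)
  then show ?thesis by (simp add: BijGroup_def Bij_def bk_move_def)
qed

end

theory Submission imports Defs begin

text \<open>A linear extension of \<open>P + Q\<close> is a shuffle of a linear extension of \<open>P\<close> and one of \<open>Q\<close>; it
  is encoded by the two and a binary shape. On the shape, \<open>t\<^sub>i\<close> is the adjacent transposition, and
  on the linear extension of \<open>P\<close> it is \<open>t\<^sub>a\<close> if places \<open>i\<close>, \<open>i + 1\<close> hold the elements number \<open>a\<close>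
  and \<open>a + 1\<close> from \<open>P\<close>, and trivial otherwise. Hence \<open>q\<^sub>m\<close> reverses the first \<open>m + 1\<close> letters of
  the shape and acts on the \<open>P\<close> part as \<open>q\<^bsub>a-1\<^esub>\<close>, where \<open>a\<close> counts the letters of \<open>P\<close> among them.
  So \<open>q\<^bsub>jk\<^esub>\<close> reverses the places \<open>j, \<dots>, k\<close> and acts on the \<open>P\<close> part as \<open>q\<^bsub>j'k'\<^esub>\<close>, and each
  \<open>(t\<^sub>i q\<^bsub>jk\<^esub>)\<^sup>2\<close> becomes either such a relation of \<open>P\<close> or a consequence of \<open>q\<^sub>m\<^sup>2 = 1\<close>.\<close>

subsection \<open>Bender--Knuth moves on arbitrary lists\<close>

text \<open>Total on lists, so that the same moves also act on shapes, which are lists with repeated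
  entries and no linear extensions.\<close>

definition bk_step :: "'a rel \<Rightarrow> nat \<Rightarrow> 'a list \<Rightarrow> 'a list" where
  "bk_step r i l =
     (if incomparable r (l ! (i - 1)) (l ! i) then l[i - 1 := l ! i, i := l ! (i - 1)] else l)"

definition bk_act :: "'a rel \<Rightarrow> nat list \<Rightarrow> 'a list \<Rightarrow> 'a list" where
  "bk_act r w l = foldr (bk_step r) w l"

lemma bk_act_simps [simp]:
  "bk_act r [] l = l"
  "bk_act r (i # w) l = bk_step r i (bk_act r w l)"
  "bk_act r (v @ w) l = bk_act r v (bk_act r w l)"
  by (simp_all add: bk_act_def)

lemma length_bk_step [simp]: "length (bk_step r i l) = length l"
  by (simp add: bk_step_def)

lemma length_bk_act [simp]: "length (bk_act r w l) = length l"
  by (induction w) simp_all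

lemma bk_step_append:
  "length xs = n \<Longrightarrow> bk_step r (Suc n) (xs @ u # v # ys) =
     (if incomparable r u v then xs @ v # u # ys else xs @ u # v # ys)"
  by (auto simp: bk_step_def nth_append list_update_append)

lemma split_at_adjacent:
  assumes "1 \<le> i" "i < length l"
  obtains xs u v ys where "l = xs @ u # v # ys" "i = Suc (length xs)"
proof
  show "l = take (i - 1) l @ l ! (i - 1) # l ! i # drop (Suc i) l"
    using assms by (metis One_nat_def Suc_diff_1 Cons_nth_drop_Suc append_take_drop_id
        less_imp_diff_less less_eq_Suc_le)
  show "i = Suc (length (take (i - 1) l))" using assms by simp
qed

lemma incomparable_sym: "incomparable r u v \<longleftrightarrow> incomparable r v u"
  by (auto simp: incomparable_def)

lemma bk_step_involution:
  assumes "1 \<le> i" "i < length l"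
  shows "bk_step r i (bk_step r i l) = l"
  using assms by (rule split_at_adjacent) (auto simp: bk_step_append incomparable_sym)

lemma bk_step_commute:
  assumes "1 \<le> i" "i + 1 < j" "j < length l"
  shows "bk_step r i (bk_step r j l) = bk_step r j (bk_step r i l)"
proof -
  from assms obtain xs u v zs where l: "l = xs @ u # v # zs" and i: "i = Suc (length xs)"
    by (metis split_at_adjacent add_lessD1 less_trans)
  have "1 \<le> j - Suc i" "j - Suc i < length zs" using assms l i by auto
  then obtain ys w z ws where zs: "zs = ys @ w # z # ws" and j: "j - Suc i = Suc (length ys)"
    by (rule split_at_adjacent)
  have j': "j = Suc (length (xs @ u # v # ys))" "j = Suc (length (xs @ v # u # ys))"
    using i j assms by auto
  \<comment> \<open>The move at \<open>j\<close> acts inside the tail \<open>zs\<close>, whichever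
    order the move at \<open>i\<close> leaves its pair in.\<close>
  have "bk_step r j (xs @ p # q # zs) = xs @ p # q # bk_step r (j - Suc i) zs" for p q
    using bk_step_append[of "xs @ p # q # ys" "j - 1" r w z ws] j' j zs
    by (auto simp: bk_step_append)
  then show ?thesis
    using l i by (simp add: bk_step_append)
qed

lemma bk_act_commute:
  assumes "\<forall>i\<in>set w. 1 \<le> i \<and> i + 1 < j" "j < length l"
  shows "bk_act r w (bk_step r j l) = bk_step r j (bk_act r w l)"
  using assms by (induction w) (auto intro!: bk_step_commute)

lemma bk_act_rev:
  assumes "set w \<subseteq> {1..<length l}"
  shows "bk_act r (rev w) (bk_act r w l) = l"
  using assms by (induction w) (simp_all add: bk_step_involution)

subsection \<open>The words \<open>q\<^sub>m\<close>\<close>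

lemma q_word_0 [simp]: "q_word 0 = []"
  by (simp add: q_word_def)

lemma q_word_Suc: "q_word (Suc m) = q_word m @ rev [1..<Suc (Suc m)]"
  by (simp add: q_word_def)

lemma set_q_word: "set (q_word m) \<subseteq> {1..m}"
  by (auto simp: q_word_def)

text \<open>Mirror image of \<open>q_word_Suc\<close>. In the induction the highest move passes
  \<open>q_word m\<close>, whose letters lie at least two below it.\<close>

lemma bk_act_q_word_Suc:
  assumes "Suc m < length l"
  shows "bk_act r (q_word (Suc m)) l = bk_act r [1..<Suc (Suc m)] (bk_act r (q_word m) l)"
  using assms
proof (induction m arbitrary: l)
  case 0
  show ?case by (simp add: q_word_Suc)
next
  case (Suc m)
  have comm: "bk_act r (q_word m) (bk_step r (Suc (Suc m)) l') =
      bk_step r (Suc (Suc m)) (bk_act r (q_word m) l')" if "length l' = length l" for l'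
    using set_q_word[of m] Suc.prems that by (intro bk_act_commute) auto
  have "bk_act r (q_word (Suc (Suc m))) l =
      bk_act r [1..<Suc (Suc m)] (bk_act r (q_word m) (bk_act r (rev [1..<Suc (Suc (Suc m))]) l))"
    using Suc by (simp only: q_word_Suc[of "Suc m"] bk_act_simps) simp
  also have "\<dots> = bk_act r [1..<Suc (Suc m)]
      (bk_step r (Suc (Suc m)) (bk_act r (q_word m) (bk_act r (rev [1..<Suc (Suc m)]) l)))"
    by (simp add: comm)
  also have "\<dots> = bk_act r [1..<Suc (Suc (Suc m))] (bk_act r (q_word (Suc m)) l)"
    by (simp add: q_word_Suc)
  finally show ?case .
qed

text \<open>Expanding one factor by \<open>q_word_Suc\<close> and the other by its mirror image puts
  the square of \<open>q_word m\<close> between a word and its reverse, which cancel.\<close>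

lemma bk_act_q_word_involution:
  assumes "m < length l"
  shows "bk_act r (q_word m) (bk_act r (q_word m) l) = l"
  using assms
proof (induction m arbitrary: l)
  case (Suc m)
  define l' where "l' = bk_act r (rev [1..<Suc (Suc m)]) l"
  have "bk_act r (q_word (Suc m)) (bk_act r (q_word (Suc m)) l) =
      bk_act r [1..<Suc (Suc m)] (bk_act r (q_word m) (bk_act r (q_word m) l'))"
    using Suc.prems bk_act_q_word_Suc[of m "bk_act r (q_word (Suc m)) l" r]
    by (simp only: q_word_Suc[of m] bk_act_simps l'_def length_bk_act)
  also have "\<dots> = bk_act r [1..<Suc (Suc m)] l'"
    using Suc by (simp add: l'_def)
  also have "\<dots> = l"
    unfolding l'_def
    using Suc.prems by (intro bk_act_rev[of "rev [1..<Suc (Suc m)]", unfolded rev_rev_ident]) auto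
  finally show ?case .
qed simp

text \<open>For the empty relation every move swaps, so words act as permutations of the positions.\<close>

lemma incomparable_empty [simp]: "incomparable {} u v"
  by (simp add: incomparable_def)

lemma bk_act_empty_promotion:
  "length ys = m \<Longrightarrow> bk_act {} (rev [1..<Suc m]) (x # ys @ zs) = ys @ x # zs"
proof (induction m arbitrary: ys zs)
  case (Suc m)
  then obtain ys' y where ys: "ys = ys' @ [y]" "length ys' = m"
    by (metis length_Suc_conv_rev)
  show ?case
    using Suc.IH[OF ys(2), of "y # zs"] ys by (simp add: bk_step_append)
qed simp

text \<open>The promotion, acting first, sends the first entry behind the others, and the induction
  hypothesis reverses those.\<close>

lemma bk_act_empty_q_word:
  "length xs = Suc m \<Longrightarrow> bk_act {} (q_word m) (xs @ zs) = rev xs @ zs"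
proof (induction m arbitrary: xs zs)
  case (Suc m)
  then obtain x ys where xs: "xs = x # ys" "length ys = Suc m"
    by (metis length_Suc_conv)
  show ?case
    using Suc.IH[OF xs(2), of "x # zs"] bk_act_empty_promotion[OF xs(2), of x zs] xs
    by (simp only: q_word_Suc bk_act_simps append_Cons) simp
qed (auto simp: length_Suc_conv)

text \<open>Three prefix reversals. The intermediate results are recorded because the words induced
  on a summand depend on them.\<close>

lemma bk_act_empty_qq_word:
  assumes "1 \<le> j" "j < k" "length bs = j - 1" "length cs = Suc (k - j)"
  shows "bk_act {} (q_word (k - 1)) (bs @ cs @ ds) = rev cs @ rev bs @ ds"
    and "bk_act {} (q_word (k - j) @ q_word (k - 1)) (bs @ cs @ ds) = cs @ rev bs @ ds"
    and "bk_act {} (qq_word j k) (bs @ cs @ ds) = bs @ rev cs @ ds"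
proof -
  show 1: "bk_act {} (q_word (k - 1)) (bs @ cs @ ds) = rev cs @ rev bs @ ds"
    using assms bk_act_empty_q_word[of "bs @ cs" "k - 1" ds] by simp
  show 2: "bk_act {} (q_word (k - j) @ q_word (k - 1)) (bs @ cs @ ds) = cs @ rev bs @ ds"
    using assms bk_act_empty_q_word[of "rev cs" "k - j" "rev bs @ ds"] 1 by simp
  show "bk_act {} (qq_word j k) (bs @ cs @ ds) = bs @ rev cs @ ds"
    using assms bk_act_empty_q_word[of "cs @ rev bs" "k - 1" ds] 2 by (simp add: qq_word_def)
qed

lemma set_qq_word: "j < k \<Longrightarrow> 1 \<le> j \<Longrightarrow> set (qq_word j k) \<subseteq> {1..<k}"
  using set_q_word[of "k - 1"] set_q_word[of "k - j"] by (fastforce simp: qq_word_def)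

subsection \<open>Relations as statements on lists\<close>

text \<open>This form passes through \<open>filter\<close> and \<open>map\<close>, as projecting to
  a summand requires.\<close>

lemma linear_extensions_iff:
  "l \<in> linear_extensions A r \<longleftrightarrow>
     distinct l \<and> set l = A \<and> sorted_wrt (\<lambda>x y. (y, x) \<notin> r) l"
proof -
  have "(\<forall>a<length l. \<forall>b<length l. (l ! a, l ! b) \<in> r \<and> l ! a \<noteq> l ! b \<longrightarrow> a < b) \<longleftrightarrow>
      sorted_wrt (\<lambda>x y. (y, x) \<notin> r) l" (is "?L \<longleftrightarrow> ?R") if "distinct l"
  proof
    assume ?L
    then show ?R
      using that unfolding sorted_wrt_iff_nth_less
      by (metis less_trans nat_less_le nth_eq_iff_index_eq order_less_asym)
  next
    assume ?R
    then show ?L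
      by (metis linorder_neqE_nat sorted_wrt_iff_nth_less)
  qed
  then show ?thesis by (auto simp: linear_extensions_def)
qed

lemma length_linear_extension: "l \<in> linear_extensions A r \<Longrightarrow> length l = card A"
  by (auto simp: linear_extensions_def distinct_card)

lemma one_BK: "\<one>\<^bsub>BK A r\<^esub> = (\<lambda>l\<in>linear_extensions A r. l)"
  by (simp add: BK_def BijGroup_def subgroup_generated_def)

lemma bk_step_eq_bk_move: "l \<in> linear_extensions A r \<Longrightarrow> bk_step r i l = bk_move A r i l"
  by (simp add: bk_step_def bk_move_def)

lemma bk_act_in_linear_extensions:
  assumes "set w \<subseteq> {1..<card A}" "l \<in> linear_extensions A r"
  shows "bk_act r w l \<in> linear_extensions A r"
  using assms
  by (induction w) (auto simp: bk_step_eq_bk_move bk_move_involution)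

lemma bk_act_in_Bij:
  assumes "set w \<subseteq> {1..<card A}"
  shows "restrict (bk_act r w) (linear_extensions A r) \<in> Bij (linear_extensions A r)"
proof -
  have inv: "bk_act r (rev w) (bk_act r w l) = l" "bk_act r w (bk_act r (rev w) l) = l"
    if "l \<in> linear_extensions A r" for l
    using that bk_act_rev[of w l r] bk_act_rev[of "rev w" l r] assms
    by (auto simp: length_linear_extension)
  have "bij_betw (bk_act r w) (linear_extensions A r) (linear_extensions A r)"
    using assms
    by (intro bij_betw_byWitness[where f' = "bk_act r (rev w)"])
      (auto simp: inv intro!: bk_act_in_linear_extensions)
  then show ?thesis by (simp add: Bij_def)
qed

lemma bk_eval_eq:
  assumes "set w \<subseteq> {1..<card A}"
  shows "bk_eval A r w = restrict (bk_act r w) (linear_extensions A r)"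
  using assms
proof (induction w)
  case Nil
  show ?case by (auto simp: bk_eval_def one_BK)
next
  case (Cons i w)
  let ?L = "linear_extensions A r"
  \<comment> \<open>The product of \<open>BijGroup\<close> is composition only for arguments in
    \<open>Bij\<close>, so membership of both factors comes first.\<close>
  have "bk_move A r i \<in> Bij ?L"
    using Cons.prems bk_move_in_BijGroup[of i A r] by (simp add: BijGroup_def)
  moreover have "restrict (bk_act r w) ?L \<in> Bij ?L"
    using Cons.prems by (simp add: bk_act_in_Bij)
  moreover have "bk_eval A r (i # w) = bk_move A r i \<otimes>\<^bsub>BijGroup ?L\<^esub> bk_eval A r w"
    by (simp add: bk_eval_def BK_def subgroup_generated_def)
  moreover have "bk_eval A r w = restrict (bk_act r w) ?L"
    using Cons.prems by (intro Cons.IH) simp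
  ultimately have "bk_eval A r (i # w) = compose ?L (bk_move A r i) (restrict (bk_act r w) ?L)"
    by (simp only: BijGroup_def monoid.simps restrict_apply')
  also have "\<dots> = restrict (bk_act r (i # w)) ?L"
    using Cons.prems
    unfolding compose_def
    by (intro restrict_ext) (simp add: bk_step_eq_bk_move[symmetric] bk_act_in_linear_extensions)
  finally show ?case .
qed

lemma bk_relation_holds_iff:
  assumes "set w \<subseteq> {1..<card A}"
  shows "bk_relation_holds A r w \<longleftrightarrow> (\<forall>l\<in>linear_extensions A r. bk_act r w l = l)"
  unfolding bk_relation_holds_def bk_eval_eq[OF assms] one_BK
  by (metis (no_types, lifting) restrict_apply' restrict_ext)

lemma LE_cactus_iff:
  "LE_cactus A r \<longleftrightarrow>
     (\<forall>i j k. 1 \<le> i \<and> i + 1 < j \<and> j < k \<and> k \<le> card A \<longrightarrow>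
        (\<forall>l\<in>linear_extensions A r. bk_act r ((i # qq_word j k) @ (i # qq_word j k)) l = l))"
proof -
  have "bk_relation_holds A r ((i # qq_word j k) @ (i # qq_word j k)) \<longleftrightarrow>
      (\<forall>l\<in>linear_extensions A r. bk_act r ((i # qq_word j k) @ (i # qq_word j k)) l = l)"
    if "1 \<le> i" "i + 1 < j" "j < k" "k \<le> card A" for i j k
    using that set_qq_word[of j k] by (intro bk_relation_holds_iff) fastforce
  then show ?thesis
    unfolding LE_cactus_def by (metis (no_types, lifting) Suc_1 Suc_eq_plus1 Suc_le_mono One_nat_def)
qed

subsection \<open>Projecting to a summand\<close>

text \<open>Both summands are treated at once: \<open>f\<close> is the partial inverse of the inclusion of a summand
  with order \<open>r\<close> into a poset with order \<open>R\<close>.\<close>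

locale poset_summand =
  fixes f :: "'c \<Rightarrow> 'a option" and R :: "'c rel" and r :: "'a rel"
  assumes rel_iff: "f x = Some a \<Longrightarrow> f y = Some b \<Longrightarrow> (x, y) \<in> R \<longleftrightarrow> (a, b) \<in> r"
    and unrelated: "(x, y) \<in> R \<Longrightarrow> f x = None \<longleftrightarrow> f y = None"
begin

definition shape :: "'c list \<Rightarrow> bool list" where
  "shape l = map (\<lambda>x. f x \<noteq> None) l"

definition proj :: "'c list \<Rightarrow> 'a list" where
  "proj l = map (the \<circ> f) (filter (\<lambda>x. f x \<noteq> None) l)"

abbreviation trues :: "bool list \<Rightarrow> nat" where
  "trues bs \<equiv> count_list bs True"

lemma length_shape [simp]: "length (shape l) = length l"
  by (simp add: shape_def)

lemma length_proj: "length (proj l) = trues (shape l)"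
  by (induction l) (auto simp: proj_def shape_def)

text \<open>Comparable entries have the same letter, so swapping them would not change the shape
  either; hence the empty relation.\<close>

lemma shape_bk_step:
  assumes "1 \<le> i" "i < length l"
  shows "shape (bk_step R i l) = bk_step {} i (shape l)"
  using assms
proof (rule split_at_adjacent)
  fix xs u v ys assume "l = xs @ u # v # ys" "i = Suc (length xs)"
  moreover have "f u = None \<longleftrightarrow> f v = None" if "\<not> incomparable R u v"
    using that unrelated[of u v] unrelated[of v u] by (auto simp: incomparable_def)
  ultimately show ?thesis
    by (auto simp: shape_def bk_step_append)
qed

lemma shape_bk_act:
  assumes "set w \<subseteq> {1..<length l}"
  shows "shape (bk_act R w l) = bk_act {} w (shape l)"
  using assms by (induction w) (auto simp: shape_bk_step)

text \<open>If both places belong to the summand, their entries are adjacent in the projection,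
  after \<open>trues bs\<close> others. Otherwise at most one survives the filter and the swap is
  invisible.\<close>

lemma proj_bk_step:
  assumes "shape l = bs @ b # c # cs" "length bs = n"
  shows "proj (bk_step R (Suc n) l) =
    (if b \<and> c then bk_step r (Suc (trues bs)) (proj l) else proj l)"
proof -
  obtain xs u v ys where l: "l = xs @ u # v # ys" and
    sh: "bs = shape xs" "b \<longleftrightarrow> f u \<noteq> None" "c \<longleftrightarrow> f v \<noteq> None"
    using assms(1) by (auto simp: shape_def map_eq_append_conv map_eq_Cons_conv append_eq_map_conv
        Cons_eq_map_conv)
  have "length xs = n" using sh assms(2) by simp
  note step = bk_step_append[OF this, of R u v ys, folded l]
  show ?thesis
  proof (cases "b \<and> c")
    case True
    then obtain p q where pq: "f u = Some p" "f v = Some q" using sh by auto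
    have "incomparable R u v \<longleftrightarrow> incomparable r p q"
      using rel_iff pq by (simp add: incomparable_def)
    moreover have "proj l = proj xs @ p # q # proj ys"
      by (simp add: l proj_def pq)
    ultimately show ?thesis
      using True step pq sh(1) by (auto simp: bk_step_append length_proj) (auto simp: proj_def l)
  next
    case False
    then show ?thesis using step sh by (auto simp: l proj_def)
  qed
qed

text \<open>The first entry travels rightwards. If it lies in the summand, each summand entry on its
  way yields one move of the projection; if not, no move is visible.\<close>

lemma proj_promotion:
  assumes "shape l = b # bs @ cs" "length bs = m"
  shows "proj (bk_act R (rev [1..<Suc m]) l) =
    (if b then bk_act r (rev [1..<Suc (trues bs)]) (proj l) else proj l)"
  using assms
proof (induction m arbitrary: bs cs)
  case (Suc m)
  then obtain bs' c where bs: "bs = bs' @ [c]" "length bs' = m"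
    by (metis length_Suc_conv_rev)
  define l' where "l' = bk_act R (rev [1..<Suc m]) l"
  have "length l = length (b # bs @ cs)"
    using Suc.prems(1) by (metis length_shape)
  then have "shape l' = bk_act {} (rev [1..<Suc m]) (shape l)"
    unfolding l'_def using Suc.prems by (intro shape_bk_act) auto
  then have "shape l' = bs' @ b # c # cs"
    using bk_act_empty_promotion[OF bs(2), of b "c # cs"] Suc.prems bs by simp
  then have "proj (bk_step R (Suc m) l') =
      (if b \<and> c then bk_step r (Suc (trues bs')) (proj l') else proj l')"
    using bs(2) by (rule proj_bk_step)
  moreover have "proj l' = (if b then bk_act r (rev [1..<Suc (trues bs')]) (proj l) else proj l)"
    unfolding l'_def using Suc bs by (intro Suc.IH[of bs' "c # cs"]) auto
  ultimately show ?case
    using bs by (auto simp: l'_def)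
qed simp

text \<open>The truncated \<open>trues bs - 1\<close> is harmless, as \<open>q\<^sub>0\<close> is the empty word.\<close>

lemma proj_q_word:
  assumes "shape l = bs @ cs" "length bs = Suc m"
  shows "proj (bk_act R (q_word m) l) = bk_act r (q_word (trues bs - 1)) (proj l)"
  using assms
proof (induction m arbitrary: l bs cs)
  case 0
  then obtain b where "bs = [b]" by (auto simp: length_Suc_conv)
  then show ?case by simp
next
  case (Suc m)
  then obtain b bs' where bs: "bs = b # bs'" "length bs' = Suc m"
    by (metis length_Suc_conv)
  define l' where "l' = bk_act R (rev [1..<Suc (Suc m)]) l"
  have sh: "shape l = b # bs' @ cs" using Suc.prems bs by simp
  have "length l = length (bs @ cs)"
    using Suc.prems(1) by (metis length_shape)
  then have "shape l' = bk_act {} (rev [1..<Suc (Suc m)]) (shape l)"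
    unfolding l'_def using Suc.prems by (intro shape_bk_act) auto
  then have "shape l' = bs' @ b # cs"
    using bk_act_empty_promotion[OF bs(2), of b cs] sh by simp
  then have "proj (bk_act R (q_word m) l') = bk_act r (q_word (trues bs' - 1)) (proj l')"
    using bs(2) by (rule Suc.IH)
  also have "\<dots> = bk_act r (q_word (trues bs - 1)) (proj l)"
  \<comment> \<open>If \<open>trues bs'\<close> is 0, truncation makes both words empty. Otherwise,
    for \<open>b\<close> true, \<open>q_word_Suc\<close> joins the two factors into the next
    word.\<close>
  proof (cases "trues bs'")
    case 0
    then show ?thesis
      using proj_promotion[OF sh bs(2)] bs by (simp add: l'_def)
  next
    case (Suc t)
    then show ?thesis
      using proj_promotion[OF sh bs(2)] bs unfolding l'_def[symmetric]
      by (simp add: q_word_Suc)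
  qed
  finally show ?case
    by (simp only: q_word_Suc bk_act_simps l'_def)
qed

text \<open>Here \<open>a\<close> and \<open>d\<close> count the summand entries in the first
  \<open>k\<close> places and in places \<open>j\<close> to \<open>k\<close>. For
  \<open>d >= 2\<close> the word is \<open>qq_word (a - d + 1) a\<close>; for smaller
  \<open>d\<close> its middle factor is empty.\<close>

lemma shape_proj_qq_word:
  assumes "1 \<le> j" "j < k" "shape l = bs @ cs @ ds" "length bs = j - 1" "length cs = Suc (k - j)"
  defines "a \<equiv> trues bs + trues cs" and "d \<equiv> trues cs"
  shows "shape (bk_act R (qq_word j k) l) = bs @ rev cs @ ds"
    and "proj (bk_act R (qq_word j k) l) =
      bk_act r (q_word (a - 1) @ q_word (d - 1) @ q_word (a - 1)) (proj l)"
proof -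
  note qq = bk_act_empty_qq_word[OF assms(1,2,4,5), of ds, folded assms(3)]
  have "length l = length (bs @ cs @ ds)"
    using assms(3) by (metis length_shape)
  then have len: "k \<le> length l" using assms by simp
  have sets: "set (q_word (k - 1)) \<subseteq> {1..<length l}" "set (q_word (k - j)) \<subseteq> {1..<length l}"
    "set (qq_word j k) \<subseteq> {1..<length l}"
    using set_q_word[of "k - 1"] set_q_word[of "k - j"] set_qq_word[of j k] len assms(1,2)
    by fastforce+
  show "shape (bk_act R (qq_word j k) l) = bs @ rev cs @ ds"
    using shape_bk_act[OF sets(3)] qq(3) by simp
  define l1 where "l1 = bk_act R (q_word (k - 1)) l"
  define l2 where "l2 = bk_act R (q_word (k - j)) l1"
  have sh1: "shape l1 = rev cs @ rev bs @ ds"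
    using shape_bk_act[OF sets(1)] qq(1) by (simp add: l1_def)
  have sh2: "shape l2 = cs @ rev bs @ ds"
    using shape_bk_act[of "q_word (k - j) @ q_word (k - 1)" l] sets(1,2) qq(2)
    by (simp add: l1_def l2_def)
  have "proj l1 = bk_act r (q_word (a - 1)) (proj l)"
    using proj_q_word[of l "bs @ cs" ds "k - 1"] assms by (simp add: l1_def)
  moreover have "proj l2 = bk_act r (q_word (d - 1)) (proj l1)"
    using proj_q_word[of l1 "rev cs" "rev bs @ ds" "k - j"] assms sh1 by (simp add: l2_def)
  moreover have "proj (bk_act R (q_word (k - 1)) l2) = bk_act r (q_word (a - 1)) (proj l2)"
    using proj_q_word[of l2 "cs @ rev bs" ds "k - 1"] assms sh2 by (simp add: add.commute)
  ultimately show "proj (bk_act R (qq_word j k) l) =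
      bk_act r (q_word (a - 1) @ q_word (d - 1) @ q_word (a - 1)) (proj l)"
    by (simp add: qq_word_def l1_def l2_def)
qed

text \<open>On the shape, the swap in \<open>bs\<close> and the reversal of \<open>cs\<close>
  concern disjoint places, and each occurs twice.\<close>

lemma shape_proj_cactus:
  assumes cactus: "LE_cactus A r" and pl: "proj l \<in> linear_extensions A r"
    and ijk: "1 \<le> i" "i + 1 < j" "j < k" "k \<le> length l"
  defines "w \<equiv> i # qq_word j k"
  shows "shape (bk_act R (w @ w) l) = shape l" and "proj (bk_act R (w @ w) l) = proj l"
proof -
  define bs where "bs = take (j - 1) (shape l)"
  define cs where "cs = take (Suc (k - j)) (drop (j - 1) (shape l))"
  define ds where "ds = drop (Suc (k - j)) (drop (j - 1) (shape l))"
  have sh: "shape l = bs @ cs @ ds"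
    by (simp add: bs_def cs_def ds_def del: drop_drop)
  have len: "length bs = j - 1" "length cs = Suc (k - j)"
    using ijk by (auto simp: bs_def cs_def)
  have "i < length bs" using len ijk by simp
  then obtain bs1 u v bs2 where bs: "bs = bs1 @ u # v # bs2" and i: "i = Suc (length bs1)"
    by (rule split_at_adjacent[OF ijk(1)])
  \<comment> \<open>Shape prefix after the move at \<open>i\<close>. It has as many summand letters
    as \<open>bs\<close>, so both occurrences of \<open>qq_word j k\<close> act through the same
    \<open>V\<close>.\<close>
  define bs' where "bs' = bs1 @ v # u # bs2"
  have len': "length bs' = j - 1" and tr': "trues bs' = trues bs"
    using len by (simp_all add: bs'_def bs)
  define a d where "a = trues bs + trues cs" and "d = trues cs"
  define V where "V = q_word (a - 1) @ q_word (d - 1) @ q_word (a - 1)"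
  \<comment> \<open>Index of the move induced on the projection when \<open>u\<close> and
    \<open>v\<close> both hold.\<close>
  define e where "e = Suc (trues bs1)"
  define l1 where "l1 = bk_act R (qq_word j k) l"
  define l2 where "l2 = bk_step R i l1"
  define l3 where "l3 = bk_act R (qq_word j k) l2"
  have j: "1 \<le> j" "j < k" using ijk by auto
  have sh1: "shape l1 = bs @ rev cs @ ds" and p1: "proj l1 = bk_act r V (proj l)"
    using shape_proj_qq_word[OF j sh len] by (simp_all add: l1_def V_def a_def d_def)
  have sh2: "shape l2 = bs' @ rev cs @ ds"
    using shape_bk_step[of i l1] ijk sh1
    by (simp add: l2_def l1_def bs bs'_def i bk_step_append)
  have p2: "proj l2 = (if u \<and> v then bk_step r e (proj l1) else proj l1)"
    using proj_bk_step[of l1 bs1 u v "bs2 @ rev cs @ ds"] sh1 by (simp add: l2_def bs i e_def)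
  have sh3: "shape l3 = bs' @ cs @ ds" and p3: "proj l3 = bk_act r V (proj l2)"
    using shape_proj_qq_word[OF j sh2 len'] len tr' by (simp_all add: l3_def V_def a_def d_def)
  have w: "bk_act R (w @ w) l = bk_step R i l3"
    by (simp add: w_def l1_def l2_def l3_def)
  show "shape (bk_act R (w @ w) l) = shape l"
    using shape_bk_step[of i l3] ijk sh3 sh
    unfolding w by (simp add: l3_def l2_def l1_def bs bs'_def i bk_step_append)
  have "proj (bk_step R i l3) = (if u \<and> v then bk_step r e (proj l3) else proj l3)"
    using proj_bk_step[of l3 bs1 v u "bs2 @ cs @ ds"] sh3 by (auto simp: bs'_def i e_def)
  then have p4: "proj (bk_act R (w @ w) l) =
      (if u \<and> v then bk_act r ((e # V) @ (e # V)) (proj l) else bk_act r (V @ V) (proj l))"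
    using p1 p2 p3 unfolding w by simp
  have a: "a \<le> length (proj l)"
    by (simp add: length_proj sh a_def d_def)
  have q_inv: "bk_act r (q_word (b - 1)) (bk_act r (q_word (b - 1)) p) = p"
    if "b \<le> a" "length p = length (proj l)" for b p
    using that a bk_act_q_word_involution[of "b - 1" p r] by (cases b) auto
  have d_le: "d \<le> a" by (simp add: a_def d_def)
  \<comment> \<open>\<open>V\<close> is an involution conjugated by an involution.\<close>
  have V_inv: "bk_act r V (bk_act r V (proj l)) = proj l"
    using q_inv[of a] q_inv[of d] by (simp add: V_def d_le)
  show "proj (bk_act R (w @ w) l) = proj l"
  proof (cases "u \<and> v")
    case False
    then show ?thesis using V_inv p4 by auto
  next
    case True
    \<comment> \<open>Both \<open>u\<close> and \<open>v\<close> count towards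
      \<open>trues bs\<close>, which is \<open>a - d\<close>; this gives the gap
      \<open>e + 1 < a - d + 1\<close> that the cactus relation asks for.\<close>
    then have ad: "e + 1 \<le> a - d" by (simp add: a_def d_def bs e_def)
    have "bk_act r ((e # V) @ (e # V)) (proj l) = proj l"
    proof (cases "2 \<le> d")
      case True
      then have "V = qq_word (a - d + 1) a"
        using ad by (simp add: V_def qq_word_def)
      moreover have "1 \<le> e" by (simp add: e_def)
      ultimately show ?thesis
        using cactus[unfolded LE_cactus_iff, rule_format, of e "a - d + 1" a "proj l"]
          pl a ad True by (simp add: length_linear_extension)
    next
      case False
      \<comment> \<open>Now \<open>V\<close> is \<open>q_word (a - 1)\<close> squared, hence
        trivial, and only the square of the move at \<open>e\<close> remains.\<close>
      then have "d - 1 = 0" by simp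
      then have "bk_act r V p = p" if "length p = length (proj l)" for p
        using that q_inv[of a p] by (simp add: V_def)
      moreover have "1 \<le> e" "e < length (proj l)" using a ad by (auto simp: e_def)
      ultimately show ?thesis by (simp add: bk_step_involution)
    qed
    then show ?thesis using True p4 by simp
  qed
qed

text \<open>Filtering keeps the order of entries, and \<open>f\<close> is injective where defined
  and carries the order over by \<open>rel_iff\<close>.\<close>

lemma proj_linear_extension:
  assumes "l \<in> linear_extensions C R" "A = {a. \<exists>x\<in>C. f x = Some a}"
    and "\<And>x y a. f x = Some a \<Longrightarrow> f y = Some a \<Longrightarrow> x = y"
  shows "proj l \<in> linear_extensions A r"
proof -
  let ?l = "filter (\<lambda>x. f x \<noteq> None) l"
  have l: "distinct l" "set l = C" "sorted_wrt (\<lambda>x y. (y, x) \<notin> R) l"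
    using assms(1) by (auto simp: linear_extensions_iff)
  have "inj_on (the \<circ> f) (set ?l)"
    using assms(3) by (fastforce intro: inj_onI)
  then have "distinct (proj l)"
    using l(1) by (simp add: proj_def distinct_map)
  moreover have "set (proj l) = A"
    using l(2) assms(2) by (force simp: proj_def image_iff)
  moreover have "sorted_wrt (\<lambda>x y. (y, x) \<notin> R) ?l"
    using l(3) by (rule sorted_wrt_filter)
  then have "sorted_wrt (\<lambda>x y. (y, x) \<notin> r) (proj l)"
    unfolding proj_def sorted_wrt_map
    by (rule sorted_wrt_mono_rel[rotated]) (auto simp: rel_iff)
  ultimately show ?thesis by (simp add: linear_extensions_iff)
qed

end

subsection \<open>Disjoint unions\<close>

definition left_part :: "'a + 'b \<Rightarrow> 'a option" where
  "left_part z = (case z of Inl x \<Rightarrow> Some x | Inr y \<Rightarrow> None)"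

definition right_part :: "'a + 'b \<Rightarrow> 'b option" where
  "right_part z = (case z of Inl x \<Rightarrow> None | Inr y \<Rightarrow> Some y)"

lemma left_part_simps [simp]: "left_part (Inl x) = Some x" "left_part (Inr y) = None"
  by (simp_all add: left_part_def)

lemma right_part_simps [simp]: "right_part (Inl x) = None" "right_part (Inr y) = Some y"
  by (simp_all add: right_part_def)

lemma left_part_eq_Some: "left_part z = Some x \<longleftrightarrow> z = Inl x"
  by (cases z) auto

lemma right_part_eq_Some: "right_part z = Some x \<longleftrightarrow> z = Inr x"
  by (cases z) auto

interpretation left: poset_summand left_part "sum_order r s" r for r s
  by unfold_locales (auto simp: left_part_eq_Some sum_order_def)

interpretation right: poset_summand right_part "sum_order r s" s for r s
  by unfold_locales (auto simp: right_part_eq_Some sum_order_def)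

text \<open>The shape tells which projection supplies each next entry, so the shuffle can be rebuilt
  from the front.\<close>

lemma shuffle_eqI:
  assumes "left.shape l = left.shape l'" "left.proj l = left.proj l'" "right.proj l = right.proj l'"
  shows "l = l'"
proof -
  have "length l = length l'"
    using assms(1) by (metis left.length_shape)
  then show ?thesis
    using assms
  proof (induction l l' rule: list_induct2)
    case (Cons x l y l')
    then show ?case
      by (cases x; cases y) (simp_all add: left.shape_def left.proj_def right.proj_def)
  qed simp
qed

theorem theorem3p17:
  fixes A :: "'a set" and r :: "'a rel" and B :: "'b set" and s :: "'b rel"
  assumes "finite A" and "partial_order_on A r"
    and "finite B" and "partial_order_on B s"
    and "LE_cactus A r" and "LE_cactus B s"
  shows "LE_cactus (A <+> B) (sum_order r s)"
  unfolding LE_cactus_iff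
proof (intro allI impI ballI, elim conjE)
  fix i j k l
  assume ijk: "1 \<le> i" "i + 1 < j" "j < k" "k \<le> card (A <+> B)"
    and l: "l \<in> linear_extensions (A <+> B) (sum_order r s)"
  have len: "k \<le> length l" using ijk l by (simp add: length_linear_extension)
  have "left.proj l \<in> linear_extensions A r"
    using l by (rule left.proj_linear_extension) (auto simp: left_part_eq_Some)
  note L = left.shape_proj_cactus[OF assms(5) this ijk(1-3) len]
  have "right.proj l \<in> linear_extensions B s"
    using l by (rule right.proj_linear_extension) (auto simp: right_part_eq_Some)
  note R = right.shape_proj_cactus[OF assms(6) this ijk(1-3) len]
  show "bk_act (sum_order r s) ((i # qq_word j k) @ (i # qq_word j k)) l = l"
    using L R(2) by (rule shuffle_eqI)
qed

end
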